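(* Let $m,n,p$ be integers with $3\leq m\leq n$ and $(m-1)(n-1)+1\leq p\leq(m-1)n$; put $l=(m-1)n-p$ and $u=n+l$. Let $X\in\mathscr{V}\subset\mathbb{R}^{n\times p\times m}$ and put $(W_1,\ldots,W_{m-1},W_m)=\iota(\sigma(X))$, where $W_1,\ldots,W_m\in\mathbb{R}^{u\times n}$. The following statements are equivalent. (1) $\operatorname{rank}X=p$. (2) There are an $n\times p$ real matrix $A$ and diagonal $p\times p$ real matrices $D_1,\ldots,D_m$ such that $$W_1AD_1+W_2AD_2+\cdots+W_{m-1}AD_{m-1}+W_mAD_m=O$$ and $$N=\begin{pmatrix}AD_1\\ \vdots\\ AD_{m-2}\\ A^{\leq n-l}D_{m-1}\end{pmatrix}$$ is nonsingular. (3) $\iota(\sigma(X))\in\mathcal{M}$.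
   Context: Note $u=nm-p$. For a matrix $B$, $B^{\leq i}$ denotes the matrix formed by its first $i$ rows. A tensor $T\in\mathbb{R}^{n\times p\times m}$ is written $T=(T_1;\ldots;T_m)$ with $T_k\in\mathbb{R}^{n\times p}$, and $\mathrm{fl}_2(T)$ is the $nm\times p$ matrix obtained by stacking $T_1,\ldots,T_m$ vertically. The rank of a tensor is the minimal number of terms in an expression as a sum of tensors $\mathbf{a}\otimes\mathbf{b}\otimes\mathbf{c}$. $\mathscr{V}=\{T\in\mathbb{R}^{n\times p\times m}\mid\mathrm{fl}_2(T)^{\leq p}\text{ is nonsingular}\}$, and $\sigma\colon\mathscr{V}\to\mathbb{R}^{u\times p}$ is $\sigma(T)=B(\mathrm{fl}_2(T)^{\leq p})^{-1}$, where $B$ consists of the last $u$ rows of $\mathrm{fl}_2(T)$. $\iota\colon\mathbb{R}^{u\times p}\to\mathbb{R}^{u\times nm}$ is $\iota(C)=(C,-E_u)$ with $E_u$ the identity matrix. $\mathcal{M}\subset\mathbb{R}^{u\times nm}$ is the set of all matrices $W=(W_1,\ldots,W_m)$ ($W_k\in\mathbb{R}^{u\times n}$) for which there are $A=(\mathbf{a}_1,\ldots,\mathbf{a}_p)\in\mathbb{R}^{n\times p}$ and $p\times p$ diagonal matrices $D_k=\mathrm{Diag}(d_{1k},\ldots,d_{pk})$, $1\leq k\leq m$, such that $(d_{j1}W_1+\cdots+d_{jm}W_m)\mathbf{a}_j=0$ for $1\leq j\leq p$ and the $p\times p$ matrix obtained by stacking $AD_1,\ldots,AD_{m-2},A^{\leq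 n-l}D_{m-1}$ vertically is nonsingular. *)

theory Defs
  imports "Jordan_Normal_Form.Gauss_Jordan_Elimination"
begin

text \<open>Indices start at 0: the slice \<open>T\<^sub>k\<close>, the block \<open>W\<^sub>k\<close> and the
  diagonal matrix \<open>D\<^sub>k\<close> of the mathematical text (\<open>1 \<le> k \<le> m\<close>) appear
  with index \<open>k - 1\<close>, and likewise for rows and columns of matrices. ``Nonsingular'' is
  \<^const>\<open>invertible_mat\<close>.\<close>

definition vstack :: "nat \<Rightarrow> real mat list \<Rightarrow> real mat" where
  "vstack c Bs = mat_of_rows c (concat (map rows Bs))"

definition first_rows :: "nat \<Rightarrow> real mat \<Rightarrow> real mat" where
  "first_rows i B = mat_of_rows (dim_col B) (take i (rows B))"

definition last_rows :: "nat \<Rightarrow> real mat \<Rightarrow> real mat" where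
  "last_rows i B = mat_of_rows (dim_col B) (drop (dim_row B - i) (rows B))"

text \<open>The \<open>k\<close>-th block of \<open>n\<close> consecutive columns of \<open>W = (W\<^sub>1, \<dots>, W\<^sub>m)\<close>.\<close>

definition block_cols :: "nat \<Rightarrow> real mat \<Rightarrow> nat \<Rightarrow> real mat" where
  "block_cols n W k = mat (dim_row W) n (\<lambda>(i, j). W $$ (i, k * n + j))"

text \<open>The type of matrices has no zero independent of the dimensions, so sums of lists of
  matrices take the dimensions as arguments.\<close>

definition mat_sum :: "nat \<Rightarrow> nat \<Rightarrow> real mat list \<Rightarrow> real mat" where
  "mat_sum r c Bs = foldr (+) Bs (0\<^sub>m r c)"

text \<open>A tensor in \<open>\<real>\<^bsup>n \<times> p \<times> m\<^esup>\<close> is the list of its \<open>m\<close> slices, each an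
  \<open>n \<times> p\<close> matrix; its \<open>(i, j, k)\<close> entry is \<open>(T ! k) $$ (i, j)\<close>.\<close>

type_synonym tensor = "real mat list"

definition tensors :: "nat \<Rightarrow> nat \<Rightarrow> nat \<Rightarrow> tensor set" where
  "tensors n p m = {T. length T = m \<and> set T \<subseteq> carrier_mat n p}"

definition outer_prod :: "real vec \<Rightarrow> real vec \<Rightarrow> real vec \<Rightarrow> tensor" where
  "outer_prod a b c =
     map (\<lambda>k. mat (dim_vec a) (dim_vec b) (\<lambda>(i, j). a $ i * b $ j * c $ k)) [0..<dim_vec c]"

definition tensor_sum :: "nat \<Rightarrow> nat \<Rightarrow> nat \<Rightarrow> tensor list \<Rightarrow> tensor" where
  "tensor_sum n p m Ts = foldr (map2 (+)) Ts (replicate m (0\<^sub>m n p))"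

definition pure_tensors :: "nat \<Rightarrow> nat \<Rightarrow> nat \<Rightarrow> tensor set" where
  "pure_tensors n p m =
     {outer_prod a b c | a b c. a \<in> carrier_vec n \<and> b \<in> carrier_vec p \<and> c \<in> carrier_vec m}"

definition tensor_rank :: "nat \<Rightarrow> nat \<Rightarrow> nat \<Rightarrow> tensor \<Rightarrow> nat" where
  "tensor_rank n p m T =
     (LEAST r. \<exists>Ts. length Ts = r \<and> set Ts \<subseteq> pure_tensors n p m \<and> T = tensor_sum n p m Ts)"

definition fl2 :: "nat \<Rightarrow> tensor \<Rightarrow> real mat" where
  "fl2 p T = vstack p T"

definition V_set :: "nat \<Rightarrow> nat \<Rightarrow> nat \<Rightarrow> tensor set" where
  "V_set n p m = {T \<in> tensors n p m. invertible_mat (first_rows p (fl2 p T))}"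

definition sigma_map :: "nat \<Rightarrow> nat \<Rightarrow> nat \<Rightarrow> tensor \<Rightarrow> real mat" where
  "sigma_map n p m T =
     last_rows (n * m - p) (fl2 p T) * the (mat_inverse (first_rows p (fl2 p T)))"

text \<open>\<open>C \<mapsto> (C, -E\<^sub>u)\<close>, where \<open>u\<close> is the number of rows of \<open>C\<close>.\<close>

definition iota_map :: "real mat \<Rightarrow> real mat" where
  "iota_map C = mat_of_cols (dim_row C) (cols C @ cols (- 1\<^sub>m (dim_row C)))"

text \<open>The matrix \<open>N\<close> obtained by stacking
  \<open>A D\<^sub>1, \<dots>, A D\<^bsub>m-2\<^esub>\<close> and the product of the first \<open>n - l\<close> rows of \<open>A\<close> with
  \<open>D\<^bsub>m-1\<^esub>\<close>.\<close>

definition N_mat ::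
  "nat \<Rightarrow> nat \<Rightarrow> nat \<Rightarrow> nat \<Rightarrow> real mat \<Rightarrow> (nat \<Rightarrow> real mat) \<Rightarrow> real mat" where
  "N_mat n p m l A D =
     vstack p (map (\<lambda>k. A * D k) [0..<m - 2] @ [first_rows (n - l) A * D (m - 2)])"

text \<open>Here \<open>d j k\<close> is the \<open>j\<close>-th diagonal entry of the \<open>k\<close>-th diagonal matrix.\<close>

definition M_set :: "nat \<Rightarrow> nat \<Rightarrow> nat \<Rightarrow> real mat set" where
  "M_set n p m = (let u = n * m - p; l = (m - 1) * n - p in
     {W \<in> carrier_mat u (n * m). \<exists>A \<in> carrier_mat n p. \<exists>d :: nat \<Rightarrow> nat \<Rightarrow> real.
        (\<forall>j < p. mat_sum u n (map (\<lambda>k. d j k \<cdot>\<^sub>m block_cols n W k) [0..<m]) *\<^sub>v col A j = 0\<^sub>v u) \<and>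
        invertible_mat (N_mat n p m l A (\<lambda>k. mat_diag p (\<lambda>j. d j k)))})"

end

theory Submission
  imports Defs "Jordan_Normal_Form.Determinant"
begin

text \<open>
  Why the theorem holds. Write \<open>F\<close> for the \<open>mn \<times> p\<close> flattening of \<open>X\<close>, \<open>P\<close> for its first
  \<open>p\<close> rows and \<open>B\<close> for its last \<open>u\<close> rows, so that \<open>W = (W\<^sub>1, \<dots>, W\<^sub>m)\<close> is \<open>(B P\<inverse>, - E\<^sub>u)\<close>.

  Collecting the three kinds of factors of \<open>r\<close> pure tensors as the columns of \<open>A\<close>, the rows of
  \<open>Q\<close> and the entries of diagonal matrices \<open>D\<^sub>k\<close>, a sum of \<open>r\<close> pure tensors is a tensor with
  slices \<open>A D\<^sub>k Q\<close> (\<open>sum_of_pure_tensors_iff\<close>). For \<open>X\<close> this reads \<open>F = S Q\<close>, where \<open>S\<close> stacks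
  the matrices \<open>A D\<^sub>k\<close>. In particular the invertible \<open>p \<times> p\<close> matrix \<open>P\<close> factors through a space
  of dimension \<open>r\<close>, so \<open>p \<le> r\<close>; therefore \<open>X\<close> has rank \<open>p\<close> exactly if \<open>F = S Q\<close> is solvable
  with \<open>r = p\<close> (\<open>tensor_rank_eq_iff\<close>).

  Because \<open>p = (m - 2) n + (n - l)\<close>, the first \<open>p\<close> rows of \<open>S\<close> are the matrix \<open>N\<close> of condition
  (2) (\<open>N_mat_eq_first_rows\<close>). Comparing the first \<open>p\<close> and the last \<open>u\<close> rows of \<open>F = S Q\<close>, the
  first give \<open>P = N Q\<close>, which forces \<open>N\<close> to be invertible and \<open>Q\<close> to be \<open>N\<inverse> P\<close>; with
  this \<open>Q\<close> the last give that the last \<open>u\<close> rows of \<open>S\<close> equal \<open>B P\<inverse> N\<close>, and that is the equation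
  \<open>W S = 0\<close> (\<open>factors_through_iff\<close>). Multiplied out in blocks, \<open>W S\<close> is the sum of the
  \<open>W\<^sub>k A D\<^sub>k\<close>, which yields condition (2) (\<open>block_product\<close>). Column \<open>j\<close> of that sum is
  \<open>(d\<^sub>j\<^sub>1 W\<^sub>1 + \<dots> + d\<^sub>j\<^sub>m W\<^sub>m) a\<^sub>j\<close>, which yields condition (3) (\<open>mat_sum_eq_0_iff_columns\<close>).
\<close>

section \<open>Invertible matrices\<close>

lemma invertible_mat_iff_det:
  fixes A :: "real mat"
  assumes A: "A \<in> carrier_mat n n"
  shows "invertible_mat A \<longleftrightarrow> det A \<noteq> 0"
proof
  assume "invertible_mat A"
  then obtain B where B: "A * B = 1\<^sub>m n" "B * A = 1\<^sub>m (dim_row B)"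
    using A unfolding invertible_mat_def inverts_mat_def by auto
  have "dim_col B = n" using arg_cong[OF B(1), of dim_col] by simp
  moreover have "dim_row B = n" using arg_cong[OF B(2), of dim_col] A by simp
  ultimately have "B \<in> carrier_mat n n" by auto
  from det_mult[OF A this] B(1) show "det A \<noteq> 0" by auto
next
  assume "det A \<noteq> 0"
  from det_non_zero_imp_unit[OF A this]
  show "invertible_mat A"
    using A unfolding Units_def ring_mat_def invertible_mat_def inverts_mat_def by auto
qed

lemma the_mat_inverse:
  fixes P :: "real mat"
  assumes P: "P \<in> carrier_mat n n" and inv: "invertible_mat P"
  shows "the (mat_inverse P) \<in> carrier_mat n n"
    and "the (mat_inverse P) * P = 1\<^sub>m n" and "P * the (mat_inverse P) = 1\<^sub>m n"
proof -
  have "P \<in> Units (ring_mat TYPE(real) n ())"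
    using det_non_zero_imp_unit[OF P, where b = "()"] inv invertible_mat_iff_det[OF P] by blast
  with mat_inverse(1)[OF P, where b = "()"] obtain B where "mat_inverse P = Some B" by (cases "mat_inverse P") auto
  with mat_inverse(2)[OF P this]
  show "the (mat_inverse P) \<in> carrier_mat n n"
    "the (mat_inverse P) * P = 1\<^sub>m n" "P * the (mat_inverse P) = 1\<^sub>m n" by auto
qed

lemma invertible_mult_iff:
  fixes A B :: "real mat"
  assumes "A \<in> carrier_mat n n" "B \<in> carrier_mat n n"
  shows "invertible_mat (A * B) \<longleftrightarrow> invertible_mat A \<and> invertible_mat B"
  using assms det_mult[OF assms] by (simp add: invertible_mat_iff_det[of _ n])

text \<open>Padding the inner dimension \<open>r < p\<close> with zeros would write the product as one of square
  matrices the first of which has a zero column, so its determinant would vanish.\<close>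

lemma invertible_product_inner_dim:
  fixes C Q :: "real mat"
  assumes C: "C \<in> carrier_mat p r" and Q: "Q \<in> carrier_mat r p" and inv: "invertible_mat (C * Q)"
  shows "p \<le> r"
proof (rule ccontr)
  assume "\<not> p \<le> r"
  then have r: "r < p" by simp
  define C' where "C' = mat p p (\<lambda>(i, t). if t < r then C $$ (i, t) else 0)"
  define Q' where "Q' = mat p p (\<lambda>(t, j). if t < r then Q $$ (t, j) else 0)"
  have C': "C' \<in> carrier_mat p p" and Q': "Q' \<in> carrier_mat p p"
    by (auto simp: C'_def Q'_def)
  have split: "(\<Sum>t = 0..<p. f t) = (\<Sum>t = 0..<r. f t)" if "\<And>t. r \<le> t \<Longrightarrow> f t = 0" for f :: "nat \<Rightarrow> real"
    by (rule sum.mono_neutral_right) (use r that in auto)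
  have "C * Q = C' * Q'"
  proof (rule eq_matI)
    fix i j assume "i < dim_row (C' * Q')" "j < dim_col (C' * Q')"
    then have ij: "i < p" "j < p" by (auto simp: C'_def Q'_def)
    have "(C' * Q') $$ (i, j)
        = (\<Sum>t = 0..<p. if t < r then C $$ (i, t) * Q $$ (t, j) else 0)"
      using ij by (auto simp: scalar_prod_def C'_def Q'_def intro!: sum.cong)
    also have "\<dots> = (\<Sum>t = 0..<r. C $$ (i, t) * Q $$ (t, j))"
      by (subst split) auto
    also have "\<dots> = (C * Q) $$ (i, j)" using ij C Q by (auto simp: scalar_prod_def)
    finally show "(C * Q) $$ (i, j) = (C' * Q') $$ (i, j)" by simp
  qed (use C Q C' Q' in auto)
  with inv have "invertible_mat C'" using invertible_mult_iff[OF C' Q'] by simp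
  moreover have "C' *\<^sub>v unit_vec p r = 0\<^sub>v p"
    by (rule eq_vecI) (auto simp: C'_def scalar_prod_def unit_vec_def intro!: sum.neutral)
  then have "det C' = 0"
    using r by (subst det_0_iff_vec_prod_zero[OF C']) (auto intro!: exI[of _ "unit_vec p r"])
  then have "\<not> invertible_mat C'" using invertible_mat_iff_det[OF C'] by simp
  ultimately show False by contradiction
qed

section \<open>Block matrices\<close>

lemma mat_sum_carrier:
  "set Bs \<subseteq> carrier_mat r c \<Longrightarrow> mat_sum r c Bs \<in> carrier_mat r c"
  unfolding mat_sum_def by (induction Bs) auto

lemma mat_sum_index:
  assumes "i < r" "j < c"
  shows "set Bs \<subseteq> carrier_mat r c \<Longrightarrow> mat_sum r c Bs $$ (i, j) = (\<Sum>B\<leftarrow>Bs. B $$ (i, j))"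
proof (induction Bs)
  case (Cons B Bs)
  have "mat_sum r c Bs \<in> carrier_mat r c" using Cons.prems by (intro mat_sum_carrier) auto
  with Cons assms show ?case by (simp add: mat_sum_def)
qed (use assms in \<open>simp add: mat_sum_def\<close>)

lemma concat_rows:
  assumes "set Bs \<subseteq> carrier_mat n c"
  shows length_concat_rows: "length (concat (map rows Bs)) = length Bs * n"
    and nth_concat_rows: "k < length Bs \<Longrightarrow> i < n \<Longrightarrow>
      concat (map rows Bs) ! (k * n + i) = row (Bs ! k) i"
  using assms
proof (induction Bs arbitrary: k)
  case (Cons B Bs)
  {
    case 1
    then show ?case using Cons.IH(1) by auto
  next
    case 2
    then show ?case using Cons.IH(2)[of "k - 1"]
      by (cases k) (auto simp: nth_append)
  }
qed auto

lemma vstack_carrier: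
  "set Bs \<subseteq> carrier_mat n c \<Longrightarrow> vstack c Bs \<in> carrier_mat (length Bs * n) c"
  using mat_of_rows_carrier(1)[of c "concat (map rows Bs)"] length_concat_rows[of Bs n c]
  unfolding vstack_def by (simp del: length_concat)

lemma block_index_less:
  fixes k i m n :: nat
  assumes "k < m" "i < n"
  shows "k * n + i < m * n"
proof -
  have "k * n + i < Suc k * n" using assms by simp
  also have "\<dots> \<le> m * n" using assms by (intro mult_le_mono1) auto
  finally show ?thesis .
qed

lemma vstack_index:
  assumes "set Bs \<subseteq> carrier_mat n c" "k < length Bs" "i < n" "j < c"
  shows "vstack c Bs $$ (k * n + i, j) = (Bs ! k) $$ (i, j)"
proof -
  have "Bs ! k \<in> carrier_mat n c" using assms nth_mem by blast
  moreover have "k * n + i < length (concat (map rows Bs))"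
    unfolding length_concat_rows[OF assms(1)] using assms block_index_less by blast
  ultimately show ?thesis
    unfolding vstack_def using assms
    by (simp add: mat_of_rows_index nth_concat_rows[OF assms(1-3)] del: length_concat)
qed

lemma vstack_eqI:
  assumes Bs: "set Bs \<subseteq> carrier_mat n c" and M: "M \<in> carrier_mat (length Bs * n) c"
    and eq: "\<And>k i j. k < length Bs \<Longrightarrow> i < n \<Longrightarrow> j < c \<Longrightarrow> (Bs ! k) $$ (i, j) = M $$ (k * n + i, j)"
  shows "vstack c Bs = M"
proof (rule eq_matI)
  fix r j assume "r < dim_row M" "j < dim_col M"
  with M have r: "r < length Bs * n" and j: "j < c" by auto
  then have "n > 0" by (cases n) auto
  then have d: "r div n < length Bs" "r mod n < n" using r by (auto simp: less_mult_imp_div_less)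
  have "vstack c Bs $$ (r div n * n + r mod n, j) = M $$ (r div n * n + r mod n, j)"
    using vstack_index[OF Bs d j] eq[OF d j] by simp
  then show "vstack c Bs $$ (r, j) = M $$ (r, j)" by simp
qed (use vstack_carrier[OF Bs] M in auto)

lemma vstack_mult:
  assumes S: "\<And>k. k < m \<Longrightarrow> S k \<in> carrier_mat n r" and Q: "Q \<in> carrier_mat r c"
  shows "vstack c (map (\<lambda>k. S k * Q) [0..<m]) = vstack r (map S [0..<m]) * Q"
proof (rule vstack_eqI[where n = n])
  have S': "set (map S [0..<m]) \<subseteq> carrier_mat n r" using S by auto
  note V = vstack_carrier[OF S']
  show "vstack r (map S [0..<m]) * Q \<in> carrier_mat (length (map (\<lambda>k. S k * Q) [0..<m]) * n) c"
    using V Q by auto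
  fix k i j assume "k < length (map (\<lambda>k. S k * Q) [0..<m])" and i: "i < n" and j: "j < c"
  then have k: "k < m" by simp
  show "(map (\<lambda>k. S k * Q) [0..<m] ! k) $$ (i, j) = (vstack r (map S [0..<m]) * Q) $$ (k * n + i, j)"
    using k i j V Q S[OF k] block_index_less[OF k i]
    by (auto simp: scalar_prod_def vstack_index[OF S'] intro!: sum.cong)
qed (use mult_carrier_mat[OF S Q] in auto)

text \<open>Multiplication of a block row with a block column: the inner summation over \<open>m * n\<close> indices
  splits into \<open>m\<close> groups of length \<open>n\<close>.\<close>

lemma block_product:
  assumes W: "W \<in> carrier_mat r (m * n)" and S: "\<And>k. k < m \<Longrightarrow> S k \<in> carrier_mat n c"
  shows "mat_sum r c (map (\<lambda>k. block_cols n W k * S k) [0..<m]) = W * vstack c (map S [0..<m])"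
proof (rule eq_matI)
  have S': "set (map S [0..<m]) \<subseteq> carrier_mat n c" using S by auto
  note V = vstack_carrier[OF S']
  have BW: "block_cols n W k \<in> carrier_mat r n" for k using W by (simp add: block_cols_def)
  have B: "set (map (\<lambda>k. block_cols n W k * S k) [0..<m]) \<subseteq> carrier_mat r c"
    using mult_carrier_mat[OF BW S] by auto
  fix i j assume "i < dim_row (W * vstack c (map S [0..<m]))" "j < dim_col (W * vstack c (map S [0..<m]))"
  with W V have i: "i < r" and j: "j < c" by auto
  have "(W * vstack c (map S [0..<m])) $$ (i, j)
      = (\<Sum>t<m * n. W $$ (i, t) * vstack c (map S [0..<m]) $$ (t, j))"
    using i j W V by (auto simp: scalar_prod_def lessThan_atLeast0)
  also have "\<dots> = (\<Sum>k<m. \<Sum>t = k * n..<k * n + n. W $$ (i, t) * vstack c (map S [0..<m]) $$ (t, j))"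
    by (rule sum.nat_group[symmetric])
  also have "\<dots> = (\<Sum>k<m. (block_cols n W k * S k) $$ (i, j))"
  proof (rule sum.cong)
    fix k assume "k \<in> {..<m}"
    then have k: "k < m" by simp
    have "(\<Sum>t = k * n..<k * n + n. W $$ (i, t) * vstack c (map S [0..<m]) $$ (t, j))
        = (\<Sum>t = 0..<n. W $$ (i, k * n + t) * vstack c (map S [0..<m]) $$ (k * n + t, j))"
      using sum.shift_bounds_nat_ivl[of "\<lambda>t. W $$ (i, t) * vstack c (map S [0..<m]) $$ (t, j)" 0 "k * n" n]
      by (simp add: add.commute)
    also have "\<dots> = (block_cols n W k * S k) $$ (i, j)"
      using i j k W S[OF k]
      by (auto simp: scalar_prod_def block_cols_def vstack_index[OF S'] intro!: sum.cong)
    finally show "(\<Sum>t = k * n..<k * n + n. W $$ (i, t) * vstack c (map S [0..<m]) $$ (t, j))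
        = (block_cols n W k * S k) $$ (i, j)" .
  qed simp
  also have "\<dots> = mat_sum r c (map (\<lambda>k. block_cols n W k * S k) [0..<m]) $$ (i, j)"
    using i j by (subst mat_sum_index[OF _ _ B]) (auto simp: comp_def interv_sum_list_conv_sum_set_nat lessThan_atLeast0)
  finally show "mat_sum r c (map (\<lambda>k. block_cols n W k * S k) [0..<m]) $$ (i, j)
      = (W * vstack c (map S [0..<m])) $$ (i, j)" by simp
next
  have S': "set (map S [0..<m]) \<subseteq> carrier_mat n c" using S by auto
  have BW: "block_cols n W k \<in> carrier_mat r n" for k using W by (simp add: block_cols_def)
  have B: "set (map (\<lambda>k. block_cols n W k * S k) [0..<m]) \<subseteq> carrier_mat r c"
    using mult_carrier_mat[OF BW S] by auto
  show "dim_row (mat_sum r c (map (\<lambda>k. block_cols n W k * S k) [0..<m])) = dim_row (W * vstack c (map S [0..<m]))"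
    "dim_col (mat_sum r c (map (\<lambda>k. block_cols n W k * S k) [0..<m])) = dim_col (W * vstack c (map S [0..<m]))"
    using mat_sum_carrier[OF B] vstack_carrier[OF S'] W by auto
qed

section \<open>Splitting off the first and the last rows\<close>

lemma first_rows_carrier: "F \<in> carrier_mat r c \<Longrightarrow> i \<le> r \<Longrightarrow> first_rows i F \<in> carrier_mat i c"
  by (auto simp: first_rows_def)

lemma last_rows_carrier: "F \<in> carrier_mat r c \<Longrightarrow> i \<le> r \<Longrightarrow> last_rows i F \<in> carrier_mat i c"
  by (auto simp: last_rows_def)

lemma first_rows_index:
  "F \<in> carrier_mat (p + u) c \<Longrightarrow> i < p \<Longrightarrow> j < c \<Longrightarrow> first_rows p F $$ (i, j) = F $$ (i, j)"
  by (simp add: first_rows_def mat_of_rows_index)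

lemma last_rows_index:
  "F \<in> carrier_mat (p + u) c \<Longrightarrow> i < u \<Longrightarrow> j < c \<Longrightarrow> last_rows u F $$ (i, j) = F $$ (p + i, j)"
  by (simp add: last_rows_def mat_of_rows_index)

lemma first_last_rows_eqI:
  assumes F: "F \<in> carrier_mat (p + u) c" and G: "G \<in> carrier_mat (p + u) c"
    and first: "first_rows p F = first_rows p G" and last: "last_rows u F = last_rows u G"
  shows "F = G"
proof (rule eq_matI)
  fix i j assume "i < dim_row G" "j < dim_col G"
  with G have i: "i < p + u" and j: "j < c" by auto
  show "F $$ (i, j) = G $$ (i, j)"
  proof (cases "i < p")
    case True
    then show ?thesis using first_rows_index[OF F True j] first_rows_index[OF G True j] first by simp
  next
    case False
    then have "i - p < u" "p + (i - p) = i" using i by auto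
    then show ?thesis
      using last_rows_index[OF F _ j, of "i - p"] last_rows_index[OF G _ j, of "i - p"] last by simp
  qed
qed (use F G in auto)

lemma first_rows_mult:
  assumes "F \<in> carrier_mat (p + u) r" "Q \<in> carrier_mat r c"
  shows "first_rows p (F * Q) = first_rows p F * Q"
proof (rule eq_matI)
  note c = first_rows_carrier[of "F * Q" "p + u" c p] first_rows_carrier[OF assms(1), of p]
  fix i j assume "i < dim_row (first_rows p F * Q)" "j < dim_col (first_rows p F * Q)"
  with assms c have "i < p" "j < c" by auto
  then show "first_rows p (F * Q) $$ (i, j) = (first_rows p F * Q) $$ (i, j)"
    using assms c
    by (simp add: first_rows_index[of "F * Q" p u c])
       (auto simp: scalar_prod_def first_rows_index[OF assms(1)] intro!: sum.cong)
qed (use assms first_rows_carrier[of "F * Q" "p + u" c p] first_rows_carrier[OF assms(1), of p] in auto)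

lemma last_rows_mult:
  assumes "F \<in> carrier_mat (p + u) r" "Q \<in> carrier_mat r c"
  shows "last_rows u (F * Q) = last_rows u F * Q"
proof (rule eq_matI)
  note c = last_rows_carrier[of "F * Q" "p + u" c u] last_rows_carrier[OF assms(1), of u]
  fix i j assume "i < dim_row (last_rows u F * Q)" "j < dim_col (last_rows u F * Q)"
  with assms c have "i < u" "j < c" by auto
  then show "last_rows u (F * Q) $$ (i, j) = (last_rows u F * Q) $$ (i, j)"
    using assms c
    by (simp add: last_rows_index[of "F * Q" p u c])
       (auto simp: scalar_prod_def last_rows_index[OF assms(1)] intro!: sum.cong)
qed (use assms last_rows_carrier[of "F * Q" "p + u" c u] last_rows_carrier[OF assms(1), of u] in auto)

lemma iota_map_carrier: "C \<in> carrier_mat u p \<Longrightarrow> iota_map C \<in> carrier_mat u (p + u)"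
  by (auto simp: iota_map_def)

lemma iota_map_mult:
  assumes C: "C \<in> carrier_mat u p" and F: "F \<in> carrier_mat (p + u) c"
  shows "iota_map C * F = C * first_rows p F - last_rows u F"
proof (rule eq_matI)
  note cf = first_rows_carrier[OF F, of p] and cl = last_rows_carrier[OF F, of u]
  note I = iota_map_carrier[OF C]
  fix i j assume "i < dim_row (C * first_rows p F - last_rows u F)" "j < dim_col (C * first_rows p F - last_rows u F)"
  with cf cl C have i: "i < u" and j: "j < c" by auto
  have I1: "iota_map C $$ (i, t) = C $$ (i, t)" if "t < p" for t
    using that i C by (simp add: iota_map_def mat_of_cols_index nth_append)
  have I2: "iota_map C $$ (i, t + p) = (if i = t then - 1 else 0)" if "t < u" for t
    using that i C by (simp add: iota_map_def mat_of_cols_index nth_append)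
  have "(iota_map C * F) $$ (i, j) = (\<Sum>t = 0..<p + u. iota_map C $$ (i, t) * F $$ (t, j))"
    using i j I F by (auto simp: scalar_prod_def)
  also have "\<dots> = (\<Sum>t = 0..<p. iota_map C $$ (i, t) * F $$ (t, j))
      + (\<Sum>t = 0..<u. iota_map C $$ (i, t + p) * F $$ (t + p, j))"
    using sum.shift_bounds_nat_ivl[of "\<lambda>t. iota_map C $$ (i, t) * F $$ (t, j)" 0 p u]
    by (subst sum.atLeastLessThan_concat[symmetric, of 0 p]) (auto simp: add.commute)
  also have "(\<Sum>t = 0..<p. iota_map C $$ (i, t) * F $$ (t, j)) = (C * first_rows p F) $$ (i, j)"
    using i j C cf by (auto simp: scalar_prod_def I1 first_rows_index[OF F] intro!: sum.cong)
  also have "(\<Sum>t = 0..<u. iota_map C $$ (i, t + p) * F $$ (t + p, j))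
      = (\<Sum>t = 0..<u. if i = t then - F $$ (p + i, j) else 0)"
    by (rule sum.cong) (auto simp: I2 add.commute)
  also have "\<dots> = - last_rows u F $$ (i, j)"
    using i j by (simp add: last_rows_index[OF F])
  finally show "(iota_map C * F) $$ (i, j) = (C * first_rows p F - last_rows u F) $$ (i, j)"
    using i j cf cl C by auto
qed (use iota_map_carrier[OF C] C F first_rows_carrier[OF F, of p] last_rows_carrier[OF F, of u] in auto)

lemma iota_map_mult_eq_0_iff:
  assumes C: "C \<in> carrier_mat u p" and F: "F \<in> carrier_mat (p + u) c"
  shows "iota_map C * F = 0\<^sub>m u c \<longleftrightarrow> last_rows u F = C * first_rows p F"
proof -
  have L: "last_rows u F \<in> carrier_mat u c" and R: "C * first_rows p F \<in> carrier_mat u c"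
    using last_rows_carrier[OF F] first_rows_carrier[OF F] C by auto
  show ?thesis unfolding iota_map_mult[OF C F]
  proof
    assume eq: "C * first_rows p F - last_rows u F = 0\<^sub>m u c"
    show "last_rows u F = C * first_rows p F"
    proof (rule eq_matI)
      fix i j assume "i < dim_row (C * first_rows p F)" "j < dim_col (C * first_rows p F)"
      then have ij: "i < u" "j < c" using R by auto
      have "(C * first_rows p F - last_rows u F) $$ (i, j) = 0" using eq ij by simp
      then show "last_rows u F $$ (i, j) = (C * first_rows p F) $$ (i, j)" using ij L R
        by (simp only: index_minus_mat carrier_matD)
    qed (use L R in auto)
  qed (use R in auto)
qed

lemma vstack_inj:
  assumes S: "set S \<subseteq> carrier_mat n c" and T: "set T \<subseteq> carrier_mat n c"
    and len: "length S = length T" and eq: "vstack c S = vstack c T"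
  shows "S = T"
proof (rule nth_equalityI[OF len])
  fix k assume k: "k < length S"
  then have "S ! k \<in> carrier_mat n c" "T ! k \<in> carrier_mat n c" using S T len by auto
  then show "S ! k = T ! k"
    using vstack_index[OF S k] vstack_index[OF T, of k] k len eq
    by (intro eq_matI) auto
qed

text \<open>The first \<open>p = (m - 2) * n + (n - l)\<close> rows of the stack of the \<open>A * D k\<close> consist of \<open>m - 2\<close> full
  blocks and the first \<open>n - l\<close> rows of the block with index \<open>m - 2\<close>; the block with index \<open>m - 1\<close>
  is cut off completely.\<close>

lemma N_mat_eq_first_rows:
  assumes A: "A \<in> carrier_mat n p" and D: "\<And>k. k < m \<Longrightarrow> D k \<in> carrier_mat p p"
    and m: "2 \<le> m" and l: "l \<le> n" and p: "p = (m - 1) * n - l"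
  shows "N_mat n p m l A D = first_rows p (vstack p (map (\<lambda>k. A * D k) [0..<m]))"
proof -
  let ?S = "\<lambda>k. A * D k"
  have S: "?S k \<in> carrier_mat n p" if "k < m" for k using A D[OF that] by auto
  obtain q where q: "m = Suc (Suc q)" using m by (metis add_2_eq_Suc le_Suc_ex)
  have p': "p = (m - 2) * n + (n - l)" using p l q by simp
  have "[0..<m] = [0..<m - 2] @ [m - 2, m - 1]" using q by simp
  then have split: "map rows (map ?S [0..<m])
      = map rows (map ?S [0..<m - 2]) @ [rows (?S (m - 2)), rows (?S (m - 1))]" by simp
  have len: "length (concat (map rows (map ?S [0..<m - 2]))) = (m - 2) * n"
    using S by (subst length_concat_rows[of _ n p]) auto
  have dims: "dim_row A = n" using A by simp
  have last_block: "rows (first_rows (n - l) A * D (m - 2)) = take (n - l) (rows (?S (m - 2)))"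
  proof -
    have Dm: "D (m - 2) \<in> carrier_mat p p" using D m by auto
    have A': "A \<in> carrier_mat ((n - l) + l) p" using A l by simp
    have "first_rows (n - l) A * D (m - 2) = first_rows (n - l) (?S (m - 2))"
      using first_rows_mult[OF A' Dm] by simp
    moreover have "set (take (n - l) (rows (?S (m - 2)))) \<subseteq> carrier_vec (dim_col (?S (m - 2)))"
      by (rule order_trans[OF set_take_subset rows_carrier])
    ultimately show ?thesis by (simp add: first_rows_def)
  qed
  have "rows (vstack p (map ?S [0..<m])) = concat (map rows (map ?S [0..<m]))"
    unfolding vstack_def using set_rows_carrier[OF S] by (intro rows_mat_of_rows) auto
  moreover have "take p (X @ Y @ Z) = X @ take (n - l) Y"
    if "length X = (m - 2) * n" "length Y = n" for X Y Z :: "real vec list"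
    using that by (simp add: p')
  ultimately have "take p (rows (vstack p (map ?S [0..<m])))
      = concat (map rows (map ?S [0..<m - 2])) @ take (n - l) (rows (?S (m - 2)))"
    using len dims by (simp only: split concat_append concat.simps append_Nil2 length_rows index_mult_mat)
  also have "\<dots> = concat (map rows (map ?S [0..<m - 2] @ [first_rows (n - l) A * D (m - 2)]))"
    by (simp add: last_block)
  finally show ?thesis
    unfolding N_mat_def first_rows_def[of p] vstack_def[of p "_ @ _"]
    by (simp add: vstack_def)
qed

text \<open>The linear algebra behind the equivalence of (1) and (2). Let \<open>P\<close>, \<open>N\<close> be the first \<open>p\<close> rows of
  \<open>F\<close>, \<open>S\<close>. The upper part of \<open>F = S * Q\<close> is \<open>P = N * Q\<close>. As \<open>P\<close> is invertible, a solution
  \<open>Q\<close> exists only if \<open>N\<close> is invertible, and then it is unique; what remains of the lower part is a condition on \<open>S\<close> alone.\<close>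

lemma factors_through_iff:
  assumes F: "F \<in> carrier_mat (p + u) p" and inv: "invertible_mat (first_rows p F)"
    and S: "S \<in> carrier_mat (p + u) p"
  shows "(\<exists>Q \<in> carrier_mat p p. F = S * Q) \<longleftrightarrow>
    invertible_mat (first_rows p S) \<and>
    iota_map (last_rows u F * the (mat_inverse (first_rows p F))) * S = 0\<^sub>m u p"
proof -
  define P where "P = first_rows p F"
  define N where "N = first_rows p S"
  define R where "R = the (mat_inverse P)"
  have P: "P \<in> carrier_mat p p" and N: "N \<in> carrier_mat p p"
    and lF: "last_rows u F \<in> carrier_mat u p" and lS: "last_rows u S \<in> carrier_mat u p"
    using first_rows_carrier[OF F, of p] first_rows_carrier[OF S, of p]
      last_rows_carrier[OF F, of u] last_rows_carrier[OF S, of u]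
    by (auto simp: P_def N_def)
  have R: "R \<in> carrier_mat p p" "R * P = 1\<^sub>m p" "P * R = 1\<^sub>m p"
    using the_mat_inverse[OF P] inv unfolding R_def P_def by auto
  have C: "last_rows u F * R \<in> carrier_mat u p" using lF R by simp
  have "(\<exists>Q \<in> carrier_mat p p. F = S * Q) \<longleftrightarrow>
      invertible_mat N \<and> last_rows u S = last_rows u F * R * N"
  proof
    assume "\<exists>Q \<in> carrier_mat p p. F = S * Q"
    then obtain Q where Q: "Q \<in> carrier_mat p p" and FS: "F = S * Q" by blast
    have PN: "P = N * Q" using first_rows_mult[OF S Q] FS by (simp add: P_def N_def)
    then have invN: "invertible_mat N" using inv invertible_mult_iff[OF N Q] by (simp add: P_def)
    \<comment> \<open>\<open>Q * R\<close> is a right inverse of the square matrix \<open>N\<close>, hence also a left inverse.\<close>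
    have "N * (Q * R) = 1\<^sub>m p" using PN R N Q by simp
    then have "Q * R * N = 1\<^sub>m p"
      using mat_mult_left_right_inverse[OF N, of "Q * R"] Q R by simp
    then have "last_rows u S = last_rows u S * (Q * R * N)" using lS by simp
    also have "\<dots> = last_rows u S * Q * R * N"
      using lS Q R N by (simp add: assoc_mult_mat[where n\<^sub>2=p and n\<^sub>3=p and n\<^sub>4=p])
    also have "\<dots> = last_rows u F * R * N" using last_rows_mult[OF S Q] FS by simp
    finally show "invertible_mat N \<and> last_rows u S = last_rows u F * R * N" using invN by simp
  next
    assume "invertible_mat N \<and> last_rows u S = last_rows u F * R * N"
    then have invN: "invertible_mat N" and lastS: "last_rows u S = last_rows u F * R * N" by auto
    define N' where "N' = the (mat_inverse N)"
    have N': "N' \<in> carrier_mat p p" "N * N' = 1\<^sub>m p"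
      using the_mat_inverse[OF N invN] by (auto simp: N'_def)
    define Q where "Q = N' * P"
    have Q: "Q \<in> carrier_mat p p" using N' P by (simp add: Q_def)
    have NQ: "N * Q = P" unfolding Q_def using N N' P by (simp flip: assoc_mult_mat)
    have "last_rows u S * Q = last_rows u F * (R * (N * Q))"
      unfolding lastS using lF R N Q by (simp add: assoc_mult_mat[where n\<^sub>2=p and n\<^sub>3=p and n\<^sub>4=p])
    also have "\<dots> = last_rows u F" using NQ R lF by simp
    finally have "last_rows u (S * Q) = last_rows u F" by (simp add: last_rows_mult[OF S Q])
    moreover have "first_rows p (S * Q) = first_rows p F"
      using NQ by (simp add: first_rows_mult[OF S Q] P_def N_def)
    ultimately have "S * Q = F"
      using first_last_rows_eqI[of "S * Q" p u p F] S Q F by simp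
    with Q show "\<exists>Q \<in> carrier_mat p p. F = S * Q" by blast
  qed
  then show ?thesis
    using iota_map_mult_eq_0_iff[OF C S] by (simp add: P_def N_def R_def)
qed

section \<open>Tensors and their rank\<close>

lemma pure_tensors_subset: "pure_tensors n p m \<subseteq> tensors n p m"
  by (auto simp: pure_tensors_def tensors_def outer_prod_def)

lemma slice_carrier: "T \<in> tensors n p m \<Longrightarrow> k < m \<Longrightarrow> T ! k \<in> carrier_mat n p"
  using nth_mem by (fastforce simp: tensors_def)

lemma tensor_sum_carrier:
  "set Ts \<subseteq> tensors n p m \<Longrightarrow> tensor_sum n p m Ts \<in> tensors n p m"
proof (induction Ts)
  case (Cons T Ts)
  then have T: "T \<in> tensors n p m" and R: "tensor_sum n p m Ts \<in> tensors n p m" by auto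
  have "T ! k + tensor_sum n p m Ts ! k \<in> carrier_mat n p" if "k < m" for k
    using slice_carrier[OF T that] slice_carrier[OF R that] by simp
  moreover have "tensor_sum n p m (T # Ts) = map2 (+) T (tensor_sum n p m Ts)"
    by (simp add: tensor_sum_def)
  ultimately show ?case using T R by (auto simp: tensors_def set_zip)
qed (auto simp: tensor_sum_def tensors_def)

lemma tensor_sum_index:
  assumes k: "k < m" and i: "i < n" and j: "j < p"
  shows "set Ts \<subseteq> tensors n p m \<Longrightarrow>
    (tensor_sum n p m Ts ! k) $$ (i, j) = (\<Sum>T\<leftarrow>Ts. (T ! k) $$ (i, j))"
proof (induction Ts)
  case (Cons T Ts)
  then have T: "T \<in> tensors n p m" and R: "tensor_sum n p m Ts \<in> tensors n p m"
    by (auto intro: tensor_sum_carrier)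
  have "tensor_sum n p m Ts ! k \<in> carrier_mat n p"
    using slice_carrier[OF R k] .
  moreover have "tensor_sum n p m (T # Ts) = map2 (+) T (tensor_sum n p m Ts)"
    by (simp add: tensor_sum_def)
  moreover have "length T = m" "length (tensor_sum n p m Ts) = m" using T R by (auto simp: tensors_def)
  ultimately show ?case using Cons.IH Cons.prems k i j by simp
qed (use assms in \<open>simp add: tensor_sum_def\<close>)

lemma tensor_eqI:
  assumes "S \<in> tensors n p m" "T \<in> tensors n p m"
    and "\<And>k i j. k < m \<Longrightarrow> i < n \<Longrightarrow> j < p \<Longrightarrow> (S ! k) $$ (i, j) = (T ! k) $$ (i, j)"
  shows "S = T"
proof (rule nth_equalityI)
  show "length S = length T" using assms by (simp add: tensors_def)
  fix k assume "k < length S"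
  then have "k < m" "S ! k \<in> carrier_mat n p" "T ! k \<in> carrier_mat n p"
    using assms(1,2) slice_carrier by (auto simp: tensors_def)
  then show "S ! k = T ! k" using assms(3) by (intro eq_matI) auto
qed

text \<open>The tensor with the canonical polyadic (CP) decomposition into the \<open>r\<close> pure tensors
  \<open>col A t \<otimes> row Q t \<otimes> d t\<close>, written slice by slice; the vector \<open>d t\<close> contributes its \<open>k\<close>-th
  entry to the \<open>k\<close>-th slice.\<close>

definition cp_tensor :: "nat \<Rightarrow> nat \<Rightarrow> real mat \<Rightarrow> (nat \<Rightarrow> nat \<Rightarrow> real) \<Rightarrow> real mat \<Rightarrow> tensor" where
  "cp_tensor r m A d Q = map (\<lambda>k. A * mat_diag r (\<lambda>t. d t k) * Q) [0..<m]"

lemma cp_tensor_carrier: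
  "A \<in> carrier_mat n r \<Longrightarrow> Q \<in> carrier_mat r p \<Longrightarrow> cp_tensor r m A d Q \<in> tensors n p m"
  by (auto simp: cp_tensor_def tensors_def intro!: mult_carrier_mat[of _ n r])

lemma cp_tensor_index:
  assumes "A \<in> carrier_mat n r" "Q \<in> carrier_mat r p" "k < m" "i < n" "j < p"
  shows "(cp_tensor r m A d Q ! k) $$ (i, j) = (\<Sum>t<r. A $$ (i, t) * d t k * Q $$ (t, j))"
  using assms
  by (auto simp: cp_tensor_def mat_diag_mult_right[of A n] scalar_prod_def lessThan_atLeast0 intro!: sum.cong)

text \<open>Both sides list the same data: the three vectors of the \<open>t\<close>-th pure tensor are the \<open>t\<close>-th column
  of \<open>A\<close>, the \<open>t\<close>-th row of \<open>Q\<close> and \<open>d t\<close>.\<close>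

lemma sum_of_pure_tensors_iff:
  "(\<exists>Ts. length Ts = r \<and> set Ts \<subseteq> pure_tensors n p m \<and> T = tensor_sum n p m Ts) \<longleftrightarrow>
   (\<exists>A \<in> carrier_mat n r. \<exists>Q \<in> carrier_mat r p. \<exists>d. T = cp_tensor r m A d Q)"
proof
  assume "\<exists>Ts. length Ts = r \<and> set Ts \<subseteq> pure_tensors n p m \<and> T = tensor_sum n p m Ts"
  then obtain Ts where len: "length Ts = r" and pure: "set Ts \<subseteq> pure_tensors n p m"
    and T: "T = tensor_sum n p m Ts" by blast
  have sub: "set Ts \<subseteq> tensors n p m" using pure pure_tensors_subset by blast
  have "\<forall>t<r. \<exists>a b c. Ts ! t = outer_prod a b c \<and> a \<in> carrier_vec n \<and> b \<in> carrier_vec p \<and> c \<in> carrier_vec m"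
  proof (intro allI impI)
    fix t assume "t < r"
    then have "Ts ! t \<in> pure_tensors n p m" using pure len by auto
    then show "\<exists>a b c. Ts ! t = outer_prod a b c \<and> a \<in> carrier_vec n \<and> b \<in> carrier_vec p \<and> c \<in> carrier_vec m"
      by (auto simp: pure_tensors_def)
  qed
  then obtain a b c where abc: "\<And>t. t < r \<Longrightarrow> Ts ! t = outer_prod (a t) (b t) (c t) \<and>
      a t \<in> carrier_vec n \<and> b t \<in> carrier_vec p \<and> c t \<in> carrier_vec m"
    by metis
  define A where "A = mat n r (\<lambda>(i, t). a t $ i)"
  define Q where "Q = mat r p (\<lambda>(t, j). b t $ j)"
  have A: "A \<in> carrier_mat n r" and Q: "Q \<in> carrier_mat r p" by (auto simp: A_def Q_def)
  have "T = cp_tensor r m A (\<lambda>t k. c t $ k) Q"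
  proof (rule tensor_eqI)
    fix k i j assume k: "k < m" and i: "i < n" and j: "j < p"
    have "(T ! k) $$ (i, j) = (\<Sum>t<r. (Ts ! t ! k) $$ (i, j))"
      unfolding T using tensor_sum_index[OF k i j sub] len
      by (simp add: sum_list_sum_nth lessThan_atLeast0)
    also have "\<dots> = (\<Sum>t<r. A $$ (i, t) * c t $ k * Q $$ (t, j))"
    proof (rule sum.cong)
      fix t assume "t \<in> {..<r}"
      then show "(Ts ! t ! k) $$ (i, j) = A $$ (i, t) * c t $ k * Q $$ (t, j)"
        using abc[of t] k i j by (auto simp: outer_prod_def A_def Q_def)
    qed simp
    finally show "(T ! k) $$ (i, j) = (cp_tensor r m A (\<lambda>t k. c t $ k) Q ! k) $$ (i, j)"
      by (simp add: cp_tensor_index[OF A Q k i j])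
  qed (use T tensor_sum_carrier[OF sub] cp_tensor_carrier[OF A Q] in auto)
  with A Q show "\<exists>A \<in> carrier_mat n r. \<exists>Q \<in> carrier_mat r p. \<exists>d. T = cp_tensor r m A d Q" by blast
next
  assume "\<exists>A \<in> carrier_mat n r. \<exists>Q \<in> carrier_mat r p. \<exists>d. T = cp_tensor r m A d Q"
  then obtain A Q d where A: "A \<in> carrier_mat n r" and Q: "Q \<in> carrier_mat r p"
    and T: "T = cp_tensor r m A d Q" by blast
  define Ts where "Ts = map (\<lambda>t. outer_prod (col A t) (row Q t) (vec m (d t))) [0..<r]"
  have pure: "set Ts \<subseteq> pure_tensors n p m"
  proof
    fix U assume "U \<in> set Ts"
    then obtain t where "t < r" "U = outer_prod (col A t) (row Q t) (vec m (d t))"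
      by (auto simp: Ts_def)
    moreover have "col A t \<in> carrier_vec n" "row Q t \<in> carrier_vec p" "vec m (d t) \<in> carrier_vec m"
      using A Q by auto
    ultimately show "U \<in> pure_tensors n p m" unfolding pure_tensors_def by blast
  qed
  then have sub: "set Ts \<subseteq> tensors n p m" using pure_tensors_subset by blast
  have "T = tensor_sum n p m Ts"
  proof (rule tensor_eqI)
    fix k i j assume k: "k < m" and i: "i < n" and j: "j < p"
    have "(\<Sum>U\<leftarrow>Ts. (U ! k) $$ (i, j)) = (\<Sum>t<r. A $$ (i, t) * d t k * Q $$ (t, j))"
      using A Q k i j
      by (auto simp: Ts_def comp_def interv_sum_list_conv_sum_set_nat lessThan_atLeast0 outer_prod_def intro!: sum.cong)
    then show "(T ! k) $$ (i, j) = (tensor_sum n p m Ts ! k) $$ (i, j)"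
      by (simp add: T cp_tensor_index[OF A Q k i j] tensor_sum_index[OF k i j sub])
  qed (use T tensor_sum_carrier[OF sub] cp_tensor_carrier[OF A Q] in auto)
  with pure show "\<exists>Ts. length Ts = r \<and> set Ts \<subseteq> pure_tensors n p m \<and> T = tensor_sum n p m Ts"
    by (intro exI[of _ Ts]) (simp add: Ts_def)
qed

text \<open>The rank is a least number, which is meaningful only if some decomposition exists. Put
  the slices of \<open>T\<close> side by side to obtain \<open>A\<close>, stack \<open>m\<close> identity matrices to obtain \<open>Q\<close>, and let
  the diagonal matrix of slice \<open>k\<close> select the \<open>k\<close>-th block.\<close>

lemma cp_tensor_exists:
  assumes T: "T \<in> tensors n p m"
  shows "\<exists>A \<in> carrier_mat n (m * p). \<exists>Q \<in> carrier_mat (m * p) p. \<exists>d. T = cp_tensor (m * p) m A d Q"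
proof -
  define A where "A = mat n (m * p) (\<lambda>(i, t). (T ! (t div p)) $$ (i, t mod p))"
  define Q where "Q = mat (m * p) p (\<lambda>(t, j). of_bool (t mod p = j) :: real)"
  define d :: "nat \<Rightarrow> nat \<Rightarrow> real" where "d t k = of_bool (t div p = k)" for t k
  have A: "A \<in> carrier_mat n (m * p)" and Q: "Q \<in> carrier_mat (m * p) p" by (auto simp: A_def Q_def)
  have "T = cp_tensor (m * p) m A d Q"
  proof (rule tensor_eqI[OF T cp_tensor_carrier[OF A Q]])
    fix k i j assume k: "k < m" and i: "i < n" and j: "j < p"
    note t0 = block_index_less[OF k j]
    have "(\<Sum>t<m * p. A $$ (i, t) * d t k * Q $$ (t, j))
        = (\<Sum>t<m * p. if t = k * p + j then (T ! k) $$ (i, j) else 0)"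
    proof (rule sum.cong)
      fix t assume "t \<in> {..<m * p}"
      then have t: "t < m * p" by simp
      have "t = k * p + j \<longleftrightarrow> t div p = k \<and> t mod p = j"
        using j div_mult_mod_eq[of t p] by auto
      then show "A $$ (i, t) * d t k * Q $$ (t, j) = (if t = k * p + j then (T ! k) $$ (i, j) else 0)"
        using t i j by (auto simp: A_def Q_def d_def)
    qed simp
    also have "\<dots> = (T ! k) $$ (i, j)" using t0 by simp
    finally show "(T ! k) $$ (i, j) = (cp_tensor (m * p) m A d Q ! k) $$ (i, j)"
      by (simp add: cp_tensor_index[OF A Q k i j])
  qed
  with A Q show ?thesis by blast
qed

lemma fl2_cp_tensor:
  assumes "A \<in> carrier_mat n r" "Q \<in> carrier_mat r p"
  shows "fl2 p (cp_tensor r m A d Q) = vstack r (map (\<lambda>k. A * mat_diag r (\<lambda>t. d t k)) [0..<m]) * Q"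
  unfolding fl2_def cp_tensor_def
  using assms by (intro vstack_mult[where n = n]) (auto intro!: mult_carrier_mat[of _ n r])

lemma fl2_inj:
  assumes "S \<in> tensors n p m" "T \<in> tensors n p m" "fl2 p S = fl2 p T"
  shows "S = T"
  using assms by (intro vstack_inj[of S n p T]) (auto simp: tensors_def fl2_def)

lemma fl2_carrier: "T \<in> tensors n p m \<Longrightarrow> fl2 p T \<in> carrier_mat (m * n) p"
  using vstack_carrier[of T n p] by (simp add: tensors_def fl2_def)

lemma cp_stack_carrier:
  assumes A: "A \<in> carrier_mat n r"
  shows "vstack r (map (\<lambda>k. A * mat_diag r (\<lambda>t. d t k)) [0..<m]) \<in> carrier_mat (m * n) r"
proof -
  have "set (map (\<lambda>k. A * mat_diag r (\<lambda>t. d t k)) [0..<m]) \<subseteq> carrier_mat n r"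
    using mult_carrier_mat[OF A mat_diag_dim] by auto
  from vstack_carrier[OF this] show ?thesis by simp
qed

text \<open>On the set of tensors whose upper \<open>p \<times> p\<close> part is nonsingular no decomposition has fewer
  than \<open>p\<close> terms, since that part factors through the inner dimension of the decomposition. Hence
  one with exactly \<open>p\<close> terms already determines the rank.\<close>

lemma tensor_rank_eq_iff:
  assumes X: "X \<in> V_set n p m" and p: "p \<le> m * n"
  shows "tensor_rank n p m X = p \<longleftrightarrow>
    (\<exists>A \<in> carrier_mat n p. \<exists>Q \<in> carrier_mat p p. \<exists>d. X = cp_tensor p m A d Q)"
proof -
  let ?ex = "\<lambda>r. \<exists>A \<in> carrier_mat n r. \<exists>Q \<in> carrier_mat r p. \<exists>d. X = cp_tensor r m A d Q"
  have rank: "tensor_rank n p m X = (LEAST r. ?ex r)"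
    unfolding tensor_rank_def sum_of_pure_tensors_iff by (rule refl)
  have "X \<in> tensors n p m" using X by (simp add: V_set_def)
  then have ex: "\<exists>r. ?ex r" using cp_tensor_exists by blast
  have lower: "p \<le> r" if "?ex r" for r
  proof -
    from that obtain A Q d where A: "A \<in> carrier_mat n r" and Q: "Q \<in> carrier_mat r p"
      and XQ: "X = cp_tensor r m A d Q" by blast
    let ?S = "vstack r (map (\<lambda>k. A * mat_diag r (\<lambda>t. d t k)) [0..<m])"
    have S: "?S \<in> carrier_mat (p + (m * n - p)) r" using cp_stack_carrier[OF A] p by simp
    have "invertible_mat (first_rows p (?S * Q))"
      using X by (simp add: V_set_def XQ fl2_cp_tensor[OF A Q])
    then have "invertible_mat (first_rows p ?S * Q)" by (simp add: first_rows_mult[OF S Q])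
    then show "p \<le> r"
      using invertible_product_inner_dim[OF first_rows_carrier[OF S] Q] by simp
  qed
  show ?thesis
  proof
    assume "tensor_rank n p m X = p"
    then show "?ex p" using LeastI_ex[OF ex] rank by simp
  next
    assume "?ex p"
    then show "tensor_rank n p m X = p" unfolding rank by (intro Least_equality lower)
  qed
qed

section \<open>The equivalence\<close>

text \<open>This is the equivalence of (2) and (3): right multiplication by a diagonal matrix scales column
  \<open>j\<close> by its \<open>j\<close>-th entry, and the scalar can be moved to \<open>W k\<close>.\<close>

lemma mat_sum_eq_0_iff_columns:
  assumes W: "\<And>k. k < m \<Longrightarrow> W k \<in> carrier_mat u n" and A: "A \<in> carrier_mat n p"
  shows "mat_sum u p (map (\<lambda>k. W k * A * mat_diag p (\<lambda>j. d j k)) [0..<m]) = 0\<^sub>m u p \<longleftrightarrow>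
    (\<forall>j<p. mat_sum u n (map (\<lambda>k. d j k \<cdot>\<^sub>m W k) [0..<m]) *\<^sub>v col A j = 0\<^sub>v u)"
proof -
  let ?Bs = "map (\<lambda>k. W k * A * mat_diag p (\<lambda>j. d j k)) [0..<m]"
  let ?Cs = "\<lambda>j. map (\<lambda>k. d j k \<cdot>\<^sub>m W k) [0..<m]"
  have B: "set ?Bs \<subseteq> carrier_mat u p" using mult_carrier_mat[OF mult_carrier_mat[OF W A]] by auto
  have C: "set (?Cs j) \<subseteq> carrier_mat u n" for j using W by auto
  note dB = mat_sum_carrier[OF B] and dC = mat_sum_carrier[OF C]
  have entry: "mat_sum u p ?Bs $$ (i, j) = (mat_sum u n (?Cs j) *\<^sub>v col A j) $ i"
    if i: "i < u" and j: "j < p" for i j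
  proof -
    have "mat_sum u p ?Bs $$ (i, j) = (\<Sum>k = 0..<m. (W k * A * mat_diag p (\<lambda>j. d j k)) $$ (i, j))"
      using mat_sum_index[OF i j B] by (simp add: comp_def interv_sum_list_conv_sum_set_nat)
    also have "\<dots> = (\<Sum>k = 0..<m. \<Sum>s = 0..<n. d j k * W k $$ (i, s) * A $$ (s, j))"
    proof (rule sum.cong)
      fix k assume "k \<in> {0..<m}"
      then have Wk: "W k \<in> carrier_mat u n" using W by simp
      have WA: "W k * A \<in> carrier_mat u p" using Wk A by simp
      show "(W k * A * mat_diag p (\<lambda>j. d j k)) $$ (i, j) = (\<Sum>s = 0..<n. d j k * W k $$ (i, s) * A $$ (s, j))"
        using i j Wk A
        by (auto simp: mat_diag_mult_right[OF WA] scalar_prod_def sum_distrib_left sum_distrib_right mult_ac)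
    qed simp
    also have "\<dots> = (\<Sum>s = 0..<n. (\<Sum>k = 0..<m. d j k * W k $$ (i, s)) * A $$ (s, j))"
      by (subst sum.swap) (simp add: sum_distrib_right)
    also have "\<dots> = (\<Sum>s = 0..<n. mat_sum u n (?Cs j) $$ (i, s) * A $$ (s, j))"
    proof (intro sum.cong refl arg_cong2[where f = "(*)"])
      fix s assume "s \<in> {0..<n}"
      then have s: "s < n" by simp
      have "(d j k \<cdot>\<^sub>m W k) $$ (i, s) = d j k * W k $$ (i, s)" if "k < m" for k
        using W[OF that] i s by simp
      then show "(\<Sum>k = 0..<m. d j k * W k $$ (i, s)) = mat_sum u n (?Cs j) $$ (i, s)"
        using mat_sum_index[OF i s C] by (simp add: comp_def interv_sum_list_conv_sum_set_nat)
    qed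
    also have "\<dots> = (mat_sum u n (?Cs j) *\<^sub>v col A j) $ i"
      using i j A dC[of j] by (auto simp: scalar_prod_def)
    finally show ?thesis .
  qed
  show ?thesis
  proof
    assume 0: "mat_sum u p ?Bs = 0\<^sub>m u p"
    show "\<forall>j<p. mat_sum u n (?Cs j) *\<^sub>v col A j = 0\<^sub>v u"
    proof (intro allI impI eq_vecI)
      fix j i assume "j < p" "i < dim_vec (0\<^sub>v u)"
      then show "(mat_sum u n (?Cs j) *\<^sub>v col A j) $ i = 0\<^sub>v u $ i"
        using entry[of i j] by (simp add: 0)
    next
      fix j show "dim_vec (mat_sum u n (?Cs j) *\<^sub>v col A j) = dim_vec (0\<^sub>v u)"
        using dC[of j] by simp
    qed
  next
    assume 0: "\<forall>j<p. mat_sum u n (?Cs j) *\<^sub>v col A j = 0\<^sub>v u"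
    show "mat_sum u p ?Bs = 0\<^sub>m u p"
      using entry dB 0 by (intro eq_matI) auto
  qed
qed

lemma N_mat_cong:
  assumes "2 \<le> m" "\<And>k. k < m \<Longrightarrow> D k = D' k"
  shows "N_mat n p m l A D = N_mat n p m l A D'"
proof -
  have "map (\<lambda>k. A * D k) [0..<m - 2] = map (\<lambda>k. A * D' k) [0..<m - 2]" using assms by auto
  moreover have "D (m - 2) = D' (m - 2)" using assms by simp
  ultimately show ?thesis unfolding N_mat_def by (simp only:)
qed

lemma diagonal_mat_eq_mat_diag:
  "D \<in> carrier_mat p p \<Longrightarrow> diagonal_mat D \<Longrightarrow> D = mat_diag p (\<lambda>j. D $$ (j, j))"
  by (intro eq_matI) (auto simp: mat_diag_def diagonal_mat_def)

text \<open>Turns the families of diagonal matrices of condition (2) into families of diagonal entries, as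
  used in (3) and in the decompositions. A family indexed by all natural numbers is constrained
  only below \<open>m\<close>, so \<open>R\<close> must not depend on the other members.\<close>

lemma ex_diagonal_family_iff:
  assumes "\<And>D D'. (\<And>k. k < m \<Longrightarrow> D k = D' k) \<Longrightarrow> R D \<longleftrightarrow> R D'"
  shows "(\<exists>D :: nat \<Rightarrow> real mat. (\<forall>k<m. D k \<in> carrier_mat p p \<and> diagonal_mat (D k)) \<and> R D)
     \<longleftrightarrow> (\<exists>d. R (\<lambda>k. mat_diag p (\<lambda>j. d j k)))"
proof
  assume "\<exists>D. (\<forall>k<m. D k \<in> carrier_mat p p \<and> diagonal_mat (D k)) \<and> R D"
  then obtain D where D: "\<And>k. k < m \<Longrightarrow> D k \<in> carrier_mat p p \<and> diagonal_mat (D k)" and "R D" by blast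
  moreover have "R D \<longleftrightarrow> R (\<lambda>k. mat_diag p (\<lambda>j. D k $$ (j, j)))"
    using D diagonal_mat_eq_mat_diag by (intro assms) blast
  ultimately show "\<exists>d. R (\<lambda>k. mat_diag p (\<lambda>j. d j k))"
    by (intro exI[of _ "\<lambda>j k. D k $$ (j, j)"]) simp
next
  assume "\<exists>d. R (\<lambda>k. mat_diag p (\<lambda>j. d j k))"
  then obtain d where "R (\<lambda>k. mat_diag p (\<lambda>j. d j k))" by blast
  then show "\<exists>D. (\<forall>k<m. D k \<in> carrier_mat p p \<and> diagonal_mat (D k)) \<and> R D"
    by (intro exI[of _ "\<lambda>k. mat_diag p (\<lambda>j. d j k)"]) (auto simp: diagonal_mat_def mat_diag_def)
qed

theorem theorem6p5:
  fixes m n p l u :: nat and X :: tensor and W :: "nat \<Rightarrow> real mat"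
  assumes "3 \<le> m" and "m \<le> n"
    and "(m - 1) * (n - 1) + 1 \<le> p" and "p \<le> (m - 1) * n"
    and "l = (m - 1) * n - p" and "u = n + l"
    and "X \<in> V_set n p m"
    and "\<And>k. k < m \<Longrightarrow> W k = block_cols n (iota_map (sigma_map n p m X)) k"
  shows "(tensor_rank n p m X = p \<longleftrightarrow>
          (\<exists>A \<in> carrier_mat n p. \<exists>D :: nat \<Rightarrow> real mat.
             (\<forall>k < m. D k \<in> carrier_mat p p \<and> diagonal_mat (D k)) \<and>
             mat_sum u p (map (\<lambda>k. W k * A * D k) [0..<m]) = 0\<^sub>m u p \<and>
             invertible_mat (N_mat n p m l A D)))
       \<and> ((\<exists>A \<in> carrier_mat n p. \<exists>D :: nat \<Rightarrow> real mat.
             (\<forall>k < m. D k \<in> carrier_mat p p \<and> diagonal_mat (D k)) \<and>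
             mat_sum u p (map (\<lambda>k. W k * A * D k) [0..<m]) = 0\<^sub>m u p \<and>
             invertible_mat (N_mat n p m l A D))
          \<longleftrightarrow> iota_map (sigma_map n p m X) \<in> M_set n p m)"
proof -
  define F where "F = fl2 p X"
  define I where "I = iota_map (sigma_map n p m X)"
  have m2: "2 \<le> m" using assms(1) by simp
  have mn: "m * n = (m - 1) * n + n" using assms(1) by (cases m) auto
  have pu: "m * n = p + u" using assms(4-6) mn by simp
  have u_eq: "n * m - p = u" using pu by (simp add: mult.commute)
  have p_eq: "p = (m - 1) * n - l" using assms(4,5) by simp
  \<comment> \<open>The lower bound on \<open>p\<close> gives \<open>l \<le> m - 2\<close>, and \<open>m \<le> n\<close>; so \<open>n - l\<close> is not truncated.\<close>
  have l_le: "l \<le> n"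
  proof -
    have "(m - 1) * n = (m - 1) * (n - 1) + (m - 1)"
      using assms(1,2) by (cases n) auto
    then show ?thesis using assms(2,3,5) by linarith
  qed
  have X: "X \<in> tensors n p m" and inv: "invertible_mat (first_rows p F)"
    using assms(7) by (auto simp: V_set_def F_def)
  have F: "F \<in> carrier_mat (p + u) p" using fl2_carrier[OF X] by (simp add: F_def pu)
  have sigma: "sigma_map n p m X = last_rows u F * the (mat_inverse (first_rows p F))"
    by (simp add: sigma_map_def F_def u_eq)
  have "sigma_map n p m X \<in> carrier_mat u p"
    unfolding sigma
    using last_rows_carrier[OF F, of u] the_mat_inverse(1)[OF first_rows_carrier[OF F, of p] inv]
    by simp
  then have I: "I \<in> carrier_mat u (m * n)" using iota_map_carrier by (simp add: I_def pu)
  have W: "W k \<in> carrier_mat u n" if "k < m" for k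
    using assms(8)[OF that] I by (simp add: block_cols_def I_def)
  let ?D = "\<lambda>d k. mat_diag p (\<lambda>j. d j k)"
  let ?S = "\<lambda>A d. vstack p (map (\<lambda>k. A * ?D d k) [0..<m])"
  let ?R = "\<lambda>A D. mat_sum u p (map (\<lambda>k. W k * A * D k) [0..<m]) = 0\<^sub>m u p \<and>
             invertible_mat (N_mat n p m l A D)"
  \<comment> \<open>For fixed \<open>A\<close> and \<open>d\<close>, a suitable \<open>Q\<close> exists iff \<open>A\<close> and \<open>d\<close> satisfy condition (2).\<close>
  have cp: "(\<exists>Q \<in> carrier_mat p p. X = cp_tensor p m A d Q) \<longleftrightarrow> ?R A (?D d)"
    if A: "A \<in> carrier_mat n p" for A d
  proof -
    have S: "?S A d \<in> carrier_mat (p + u) p" using cp_stack_carrier[OF A, of d m] by (simp add: pu)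
    have "X = cp_tensor p m A d Q \<longleftrightarrow> F = ?S A d * Q" if Q: "Q \<in> carrier_mat p p" for Q
      using fl2_inj[OF X cp_tensor_carrier[OF A Q]] fl2_cp_tensor[OF A Q, of m d] by (auto simp: F_def)
    then have "(\<exists>Q \<in> carrier_mat p p. X = cp_tensor p m A d Q) \<longleftrightarrow>
        (\<exists>Q \<in> carrier_mat p p. F = ?S A d * Q)" by blast
    also have "\<dots> \<longleftrightarrow> invertible_mat (first_rows p (?S A d)) \<and> I * ?S A d = 0\<^sub>m u p"
      unfolding I_def sigma by (rule factors_through_iff[OF F inv S])
    also have "first_rows p (?S A d) = N_mat n p m l A (?D d)"
      using N_mat_eq_first_rows[OF A _ m2 l_le p_eq, of "?D d"] by simp
    also have "I * ?S A d = mat_sum u p (map (\<lambda>k. block_cols n I k * (A * ?D d k)) [0..<m])"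
      using block_product[OF I, of "\<lambda>k. A * ?D d k" p] A by (simp add: mult_carrier_mat[of _ n p])
    also have "map (\<lambda>k. block_cols n I k * (A * ?D d k)) [0..<m] = map (\<lambda>k. W k * A * ?D d k) [0..<m]"
    proof (rule map_cong[OF refl])
      fix k assume "k \<in> set [0..<m]"
      then have "k < m" by simp
      then show "block_cols n I k * (A * ?D d k) = W k * A * ?D d k"
        using assoc_mult_mat[OF W A mat_diag_dim] assms(8) by (simp add: I_def)
    qed
    finally show ?thesis by blast
  qed
  have cong: "?R A D \<longleftrightarrow> ?R A D'" if "\<And>k. k < m \<Longrightarrow> D k = D' k" for A D D'
  proof -
    have "map (\<lambda>k. W k * A * D k) [0..<m] = map (\<lambda>k. W k * A * D' k) [0..<m]" using that by simp
    moreover have "N_mat n p m l A D = N_mat n p m l A D'" by (rule N_mat_cong[OF m2 that])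
    ultimately show ?thesis by (simp only:)
  qed
  have two: "(\<exists>D. (\<forall>k < m. D k \<in> carrier_mat p p \<and> diagonal_mat (D k)) \<and> ?R A D) \<longleftrightarrow> (\<exists>d. ?R A (?D d))"
    for A by (rule ex_diagonal_family_iff[OF cong])
  have "tensor_rank n p m X = p \<longleftrightarrow> (\<exists>A \<in> carrier_mat n p. \<exists>d. ?R A (?D d))"
  proof -
    have "tensor_rank n p m X = p \<longleftrightarrow>
        (\<exists>A \<in> carrier_mat n p. \<exists>d. \<exists>Q \<in> carrier_mat p p. X = cp_tensor p m A d Q)"
      using tensor_rank_eq_iff[OF assms(7)] pu by auto
    also have "\<dots> \<longleftrightarrow> (\<exists>A \<in> carrier_mat n p. \<exists>d. ?R A (?D d))"
      by (simp only: cp cong: bex_cong)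
    finally show ?thesis .
  qed
  moreover have "I \<in> M_set n p m \<longleftrightarrow> (\<exists>A \<in> carrier_mat n p. \<exists>d. ?R A (?D d))"
  proof -
    have blocks: "map (\<lambda>k. d j k \<cdot>\<^sub>m block_cols n I k) [0..<m] = map (\<lambda>k. d j k \<cdot>\<^sub>m W k) [0..<m]"
      for d :: "nat \<Rightarrow> nat \<Rightarrow> real" and j
      using assms(8) by (simp add: I_def)
    have "I \<in> carrier_mat u (n * m)" using I by (simp add: mult.commute)
    then have "I \<in> M_set n p m \<longleftrightarrow> (\<exists>A \<in> carrier_mat n p. \<exists>d.
        (\<forall>j<p. mat_sum u n (map (\<lambda>k. d j k \<cdot>\<^sub>m W k) [0..<m]) *\<^sub>v col A j = 0\<^sub>v u) \<and>
        invertible_mat (N_mat n p m l A (?D d)))"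
      unfolding M_set_def Let_def u_eq assms(5)[symmetric] mem_Collect_eq blocks by blast
    also have "\<dots> \<longleftrightarrow> (\<exists>A \<in> carrier_mat n p. \<exists>d. ?R A (?D d))"
      using mat_sum_eq_0_iff_columns[of m W u n _ p, OF W] by simp
    finally show ?thesis .
  qed
  ultimately show ?thesis unfolding two I_def by simp
qed

end
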